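(* Let $\Lambda\subseteq\mathbb{Z}_{\ge 0}\times\mathbb{Z}_{\ge 0}$ contain at least one element $(s,d)$ with $d$ even. Let $(\alpha_n)$ be a sequence of integers such that $0<\alpha_n<n/2$ for all sufficiently large $n$ and $\alpha_n\to\infty$ as $n\to\infty$. Let $\epsilon>0$. Then there is $N$ such that for all $n\ge N$ the following holds. Let $S$ be a uniform random subset of $[0,n]$, let $E$ be any event that depends only on $S\cap[\alpha_n+1,n-\alpha_n-1]$, and let $F$ be any event that depends only on $S\cap([0,\alpha_n]\cup[n-\alpha_n,n])$. Then $$\bigl|\mathbb{P}(E\cap F\mid\lambda(S)\in\Lambda)-\mathbb{P}(E)\,\mathbb{P}(F\mid\lambda(S)\in\Lambda)\bigr|\le(1+\epsilon)\,\frac{24\,(3/4)^{\alpha_n/2}}{(2-\sqrt3)\,\rho^\Lambda}.$$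
   Context: $[a,b]$ denotes the set of integers $\{a,a+1,\dots,b\}$ (empty if $a>b$). For a finite set $S$ of integers, $S+S=\{s_1+s_2 : s_1,s_2\in S\}$ and $S-S=\{s_1-s_2 : s_1,s_2\in S\}$. For $S\subseteq[0,n]$, $\lambda(S)=\lambda_n(S)=(2n+1-|S+S|,\;2n+1-|S-S|)$. For $\Lambda\subseteq\mathbb{Z}_{\ge 0}\times\mathbb{Z}_{\ge 0}$, $\rho^\Lambda=\lim_{n\to\infty}2^{-n-1}\,|\{S\subseteq[0,n] : \lambda_n(S)\in\Lambda\}|$; this limit exists, and it is positive when $\Lambda$ contains some $(s,d)$ with $d$ even. "An event depends only on $S\cap X$" means that its occurrence is determined by the set $S\cap X$. *)

theory Defs
  imports "HOL-Probability.Probability" "HOL-Library.Set_Algebras"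
begin

text \<open>Set_Algebras makes \<open>S + S\<close> the elementwise sum, but \<open>S - S\<close> remains the relative
  complement, so the difference set needs its own constant.\<close>

definition diffset :: "int set \<Rightarrow> int set" where
  "diffset S = {s1 - s2 | s1 s2. s1 \<in> S \<and> s2 \<in> S}"

definition lam :: "nat \<Rightarrow> int set \<Rightarrow> int \<times> int" where
  "lam n S = (2 * int n + 1 - int (card (S + S)), 2 * int n + 1 - int (card (diffset S)))"

text \<open>The limit exists for every \<open>L \<subseteq> {0..} \<times> {0..}\<close>; \<open>lim\<close> is unspecified on divergent sequences,
  so anything proved about \<open>rho L\<close> rests on this convergence.\<close>

definition rho :: "(int \<times> int) set \<Rightarrow> real" where
  "rho L = lim (\<lambda>n. real (card {S. S \<subseteq> {0..int n} \<and> lam n S \<in> L}) / 2 ^ (n + 1))"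

definition random_subset :: "nat \<Rightarrow> int set measure" where
  "random_subset n = measure_pmf (pmf_of_set (Pow {0..int n}))"

text \<open>An event concerning a subset of \<open>{0..n}\<close> is a predicate on sets; its values
  outside \<open>Pow {0..n}\<close> are irrelevant.\<close>

definition depends_only_on :: "nat \<Rightarrow> int set \<Rightarrow> (int set \<Rightarrow> bool) \<Rightarrow> bool" where
  "depends_only_on n X E \<longleftrightarrow>
     (\<forall>S T. S \<subseteq> {0..int n} \<longrightarrow> T \<subseteq> {0..int n} \<longrightarrow> S \<inter> X = T \<inter> X \<longrightarrow> (E S \<longleftrightarrow> E T))"

end

theory Submission
  imports Defs
begin

text \<open>A sum or difference at distance \<open>j\<close> from the extreme values is represented by many disjoint pairs,
  so it is missing with probability at most \<open>q ^ j\<close> with \<open>q = sqrt 3 / 2\<close>. Hence, up to an event of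
  probability at most \<open>3 * q ^ (k + 1) / (1 - q)\<close>, the value \<open>lam n S\<close> is determined by the two fringes
  of length \<open>k\<close> of \<open>S\<close>, and the fringes are independent of the middle part. Since the distribution of
  the fringes does not depend on \<open>n > 2 * k\<close>, the same estimate shows that the limit \<open>rho L\<close> exists.
  It is positive because a prescribed fringe can be glued to both ends of a set that misses nothing,
  such sets have positive density, and fringes losing any number of sums and any even number of
  differences exist. The theorem follows once the probability of \<open>lam n S \<in> L\<close> exceeds \<open>rho L / 2\<close>,
  which accounts for the factor 24.\<close>

section \<open>Subsets avoiding disjoint pairs\<close>

text \<open>Independence in counting form: a subset of \<open>U\<close> is a free choice of its
  trace on \<open>X\<close> and of its remainder outside \<open>X\<close>.\<close>

lemma card_subsets_split:
  assumes "finite U" "X \<subseteq> U"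
  shows "card {S. S \<subseteq> U \<and> \<phi> (S \<inter> X) \<and> \<psi> (S - X)} =
    card {A. A \<subseteq> X \<and> \<phi> A} * card {B. B \<subseteq> U - X \<and> \<psi> B}"
proof -
  have "bij_betw (\<lambda>S. (S \<inter> X, S - X)) {S. S \<subseteq> U \<and> \<phi> (S \<inter> X) \<and> \<psi> (S - X)}
    ({A. A \<subseteq> X \<and> \<phi> A} \<times> {B. B \<subseteq> U - X \<and> \<psi> B})"
  proof (rule bij_betw_byWitness[where f' = "\<lambda>(A, B). A \<union> B"])
    have "(A \<union> B) \<inter> X = A \<and> A \<union> B - X = B" if "A \<subseteq> X" "B \<subseteq> U - X" for A B
      using that by blast
    then show "\<forall>p\<in>{A. A \<subseteq> X \<and> \<phi> A} \<times> {B. B \<subseteq> U - X \<and> \<psi> B}.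
        (\<lambda>S. (S \<inter> X, S - X)) ((\<lambda>(A, B). A \<union> B) p) = p"
      and "(\<lambda>(A, B). A \<union> B) ` ({A. A \<subseteq> X \<and> \<phi> A} \<times> {B. B \<subseteq> U - X \<and> \<psi> B})
        \<subseteq> {S. S \<subseteq> U \<and> \<phi> (S \<inter> X) \<and> \<psi> (S - X)}"
      using assms by auto
  qed (use assms in auto)
  then show ?thesis
    by (simp add: bij_betw_same_card card_cartesian_product)
qed

text \<open>Each pair \<open>{i, f i}\<close> admits 3 of its 4 subsets, and the points outside all
  pairs are free. Injectivity and the last assumption make the pairs disjoint, so the induction can
  split off one pair at a time. Multiplying out keeps the identity within the natural
  numbers.\<close>

lemma card_avoid_pairs:
  assumes "finite U" "I \<subseteq> U" "f ` I \<subseteq> U" "inj_on f I" "I \<inter> f ` I = {}"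
  shows "card {S. S \<subseteq> U \<and> (\<forall>i\<in>I. \<not> (i \<in> S \<and> f i \<in> S))} * 4 ^ card I = 3 ^ card I * 2 ^ card U"
proof -
  have "finite I"
    using assms finite_subset by blast
  then show ?thesis
    using assms
  proof (induction I arbitrary: U rule: finite_induct)
    case empty
    then show ?case
      by (simp add: card_Pow flip: Pow_def)
  next
    case (insert x F)
    let ?X = "{x, f x}" and ?\<phi> = "\<lambda>S. \<not> (x \<in> S \<and> f x \<in> S)"
      and ?\<psi> = "\<lambda>S. \<forall>i\<in>F. \<not> (i \<in> S \<and> f i \<in> S)"
    have out: "i \<notin> ?X" "f i \<notin> ?X" if "i \<in> F" for i
      using insert.prems insert.hyps that by (auto simp: image_iff)
    have X: "?X \<subseteq> U" "x \<noteq> f x"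
      using insert.prems by auto
    have "{S. S \<subseteq> U \<and> (\<forall>i\<in>insert x F. \<not> (i \<in> S \<and> f i \<in> S))}
        = {S. S \<subseteq> U \<and> ?\<phi> (S \<inter> ?X) \<and> ?\<psi> (S - ?X)}"
      using out by blast
    then have "card {S. S \<subseteq> U \<and> (\<forall>i\<in>insert x F. \<not> (i \<in> S \<and> f i \<in> S))}
        = card {A. A \<subseteq> ?X \<and> ?\<phi> A} * card {B. B \<subseteq> U - ?X \<and> ?\<psi> B}"
      using card_subsets_split[OF insert.prems(1) X(1), of ?\<phi> ?\<psi>] by simp
    moreover have "{A. A \<subseteq> ?X \<and> ?\<phi> A} = {{}, {x}, {f x}}"
      using X(2) by auto
    then have "card {A. A \<subseteq> ?X \<and> ?\<phi> A} = 3"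
      using X(2) by simp
    moreover have "card {B. B \<subseteq> U - ?X \<and> ?\<psi> B} * 4 ^ card F = 3 ^ card F * 2 ^ card (U - ?X)"
      by (rule insert.IH) (use insert.prems insert.hyps out in auto)
    moreover have "card U = card (U - ?X) + 2"
      using card_mono[OF insert.prems(1) X(1)] X by (simp add: card_Diff_subset)
    ultimately show ?case
      using insert.hyps by (simp add: algebra_simps)
  qed
qed

section \<open>Probabilities of events about a uniform random subset, by counting\<close>

definition pr :: "nat \<Rightarrow> (int set \<Rightarrow> bool) \<Rightarrow> real" where
  "pr n \<phi> = card {S. S \<subseteq> {0..int n} \<and> \<phi> S} / 2 ^ (n + 1)"

lemma finite_subsets [simp]: "finite {S. S \<subseteq> {a..b::int} \<and> \<phi> S}"
  by (rule finite_subset[of _ "Pow {a..b}"]) auto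

lemma pr_nonneg: "0 \<le> pr n \<phi>"
  by (simp add: pr_def)

lemma pr_mono: "(\<And>S. S \<subseteq> {0..int n} \<Longrightarrow> \<phi> S \<Longrightarrow> \<psi> S) \<Longrightarrow> pr n \<phi> \<le> pr n \<psi>"
  unfolding pr_def by (intro divide_right_mono of_nat_mono card_mono finite_subsets) auto

lemma pr_cong: "(\<And>S. S \<subseteq> {0..int n} \<Longrightarrow> \<phi> S \<longleftrightarrow> \<psi> S) \<Longrightarrow> pr n \<phi> = pr n \<psi>"
  by (intro antisym pr_mono) auto

lemma pr_True: "pr n (\<lambda>_. True) = 1"
  by (simp add: pr_def card_Pow nat_add_distrib flip: Pow_def)

lemma pr_disj_le: "pr n (\<lambda>S. \<phi> S \<or> \<psi> S) \<le> pr n \<phi> + pr n \<psi>"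
proof -
  have "{S. S \<subseteq> {0..int n} \<and> (\<phi> S \<or> \<psi> S)} =
      {S. S \<subseteq> {0..int n} \<and> \<phi> S} \<union> {S. S \<subseteq> {0..int n} \<and> \<psi> S}"
    by auto
  then have "card {S. S \<subseteq> {0..int n} \<and> (\<phi> S \<or> \<psi> S)} \<le>
      card {S. S \<subseteq> {0..int n} \<and> \<phi> S} + card {S. S \<subseteq> {0..int n} \<and> \<psi> S}"
    by (simp add: card_Un_le)
  then have "real (card {S. S \<subseteq> {0..int n} \<and> (\<phi> S \<or> \<psi> S)}) \<le>
      card {S. S \<subseteq> {0..int n} \<and> \<phi> S} + card {S. S \<subseteq> {0..int n} \<and> \<psi> S}"
    using of_nat_mono by fastforce
  then show ?thesis
    unfolding pr_def by (simp add: divide_right_mono flip: add_divide_distrib)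
qed

lemma pr_bex_le:
  assumes "finite J"
  shows "pr n (\<lambda>S. \<exists>j\<in>J. \<phi> j S) \<le> (\<Sum>j\<in>J. pr n (\<phi> j))"
  using assms
proof induction
  case (insert x F)
  then show ?case
    using pr_disj_le[of n "\<phi> x" "\<lambda>S. \<exists>j\<in>F. \<phi> j S"] by auto
qed (simp add: pr_def)

text \<open>Off the bad event \<open>\<theta>\<close> the two events agree, so one may replace the
  other at the cost of its probability. The bad event of interest is the failure of
  \<open>filled\<close>.\<close>

lemma pr_diff_le:
  assumes "\<And>S. S \<subseteq> {0..int n} \<Longrightarrow> \<not> \<theta> S \<Longrightarrow> \<phi> S \<longleftrightarrow> \<psi> S"
  shows "\<bar>pr n \<phi> - pr n \<psi>\<bar> \<le> pr n \<theta>"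
proof -
  have "pr n \<phi> \<le> pr n (\<lambda>S. \<psi> S \<or> \<theta> S)" "pr n \<psi> \<le> pr n (\<lambda>S. \<phi> S \<or> \<theta> S)"
    using assms by (auto intro!: pr_mono)
  then show ?thesis
    using pr_disj_le[of n \<phi> \<theta>] pr_disj_le[of n \<psi> \<theta>] by linarith
qed

lemma measure_random_subset: "measure (random_subset n) {S. \<phi> S} = pr n \<phi>"
proof -
  have "Pow {0..int n} \<inter> {S. \<phi> S} = {S. S \<subseteq> {0..int n} \<and> \<phi> S}"
    by auto
  then show ?thesis
    unfolding random_subset_def pr_def
    by (subst measure_pmf_of_set) (auto simp: card_Pow nat_add_distrib)
qed

lemma pr_indep:
  assumes "depends_only_on n X E" "depends_only_on n ({0..int n} - X) F" "X \<subseteq> {0..int n}"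
  shows "pr n (\<lambda>S. E S \<and> F S) = pr n E * pr n F"
proof -
  let ?U = "{0..int n}"
  have E: "E S \<longleftrightarrow> E (S \<inter> X)" and F: "F S \<longleftrightarrow> F (S - X)" if "S \<subseteq> ?U" for S
  proof -
    have "S \<inter> X = (S \<inter> X) \<inter> X" "S \<inter> (?U - X) = (S - X) \<inter> (?U - X)"
      by blast+
    moreover have "S \<inter> X \<subseteq> ?U" "S - X \<subseteq> ?U"
      using that by blast+
    ultimately show "E S \<longleftrightarrow> E (S \<inter> X)" "F S \<longleftrightarrow> F (S - X)"
      using assms(1,2) that unfolding depends_only_on_def by blast+
  qed
  let ?a = "card {A. A \<subseteq> X \<and> E A}" and ?b = "card {B. B \<subseteq> ?U - X \<and> F B}"
  have [simp]: "finite X"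
    using assms(3) finite_subset by blast
  have 1: "card {S. S \<subseteq> ?U \<and> E S \<and> F S} = ?a * ?b"
    using card_subsets_split[of ?U X E F] assms(3) E F by (simp cong: conj_cong)
  have 2: "card {S. S \<subseteq> ?U \<and> E S} = ?a * 2 ^ card (?U - X)"
    using card_subsets_split[of ?U X E "\<lambda>_. True"] assms(3) E
    by (simp add: card_Pow cong: conj_cong flip: Pow_def)
  have 3: "card {S. S \<subseteq> ?U \<and> F S} = 2 ^ card X * ?b"
    using card_subsets_split[of ?U X "\<lambda>_. True" F] assms(3) F
    by (simp add: card_Pow cong: conj_cong flip: Pow_def)
  have "card X + card (?U - X) = n + 1"
    using assms(3) card_mono[OF _ assms(3)] by (simp add: card_Diff_subset)
  then have "(2::real) ^ (n + 1) = 2 ^ card X * 2 ^ card (?U - X)"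
    by (simp flip: power_add)
  then show ?thesis
    unfolding pr_def 1 2 3 by simp
qed

section \<open>Missing sums and differences\<close>

text \<open>Avoiding \<open>c\<close> disjoint pairs has probability
  \<open>(3/4)^c = q^(2*c)\<close>. Counting half pairs through \<open>q\<close> avoids rounding
  when about \<open>m/2\<close> pairs are available.\<close>

definition q :: real where "q = sqrt 3 / 2"

lemma q_square: "q\<^sup>2 = 3 / 4"
  by (simp add: q_def power_divide)

lemma q_bounds: "1 / 2 \<le> q" "0 < q" "q < 1"
proof -
  have "sqrt 3 < sqrt 4"
    by (subst real_sqrt_less_iff) simp
  then show "q < 1"
    by (simp add: q_def)
qed (simp_all add: q_def)

lemma sum_q_power_le:
  assumes "finite J" "J \<subseteq> {m..}"
  shows "(\<Sum>j\<in>J. q ^ j) \<le> q ^ m / (1 - q)"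
proof -
  have "(\<Sum>j\<in>J. q ^ j) = (\<Sum>j\<in>J. q ^ m * q ^ (j - m))"
    using assms by (intro sum.cong) (auto simp flip: power_add)
  also have "\<dots> = q ^ m * (\<Sum>i\<in>(\<lambda>j. j - m) ` J. q ^ i)"
    using assms by (subst sum.reindex) (auto simp: sum_distrib_left intro!: inj_on_diff_nat)
  also have "\<dots> \<le> q ^ m * (\<Sum>i. q ^ i)"
    using assms q_bounds by (intro mult_left_mono sum_le_suminf summable_geometric) auto
  also have "\<dots> = q ^ m / (1 - q)"
    using q_bounds by (simp add: suminf_geometric)
  finally show ?thesis .
qed

lemma q_power_antimono: "m \<le> m' \<Longrightarrow> q ^ m' \<le> q ^ m"
  using q_bounds by (intro power_decreasing) auto

lemma pr_avoid_pairs_le: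
  assumes "I \<subseteq> {0..int n}" "f ` I \<subseteq> {0..int n}" "inj_on f I" "I \<inter> f ` I = {}" "m \<le> 2 * card I"
  shows "pr n (\<lambda>S. \<forall>i\<in>I. \<not> (i \<in> S \<and> f i \<in> S)) \<le> q ^ m"
proof -
  let ?c = "card {S. S \<subseteq> {0..int n} \<and> (\<forall>i\<in>I. \<not> (i \<in> S \<and> f i \<in> S))}"
  have "?c * 4 ^ card I = 3 ^ card I * 2 ^ (n + 1)"
    using card_avoid_pairs[OF _ assms(1-4)] by (simp add: nat_add_distrib)
  then have "real (?c * 4 ^ card I) = real (3 ^ card I * 2 ^ (n + 1))"
    by (rule arg_cong)
  then have "pr n (\<lambda>S. \<forall>i\<in>I. \<not> (i \<in> S \<and> f i \<in> S)) = (3 / 4) ^ card I"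
    by (simp add: pr_def power_divide field_simps)
  also have "\<dots> = q ^ (2 * card I)"
    by (simp add: power_mult q_square)
  also have "\<dots> \<le> q ^ m"
    by (rule q_power_antimono) fact
  finally show ?thesis .
qed

section \<open>Reflection of the interval, exchanging its two ends\<close>

definition reflect :: "nat \<Rightarrow> int set \<Rightarrow> int set" where
  "reflect n S = (\<lambda>x. int n - x) ` S"

lemma mem_reflect: "x \<in> reflect n S \<longleftrightarrow> int n - x \<in> S"
proof
  assume "int n - x \<in> S"
  then have "int n - (int n - x) \<in> reflect n S"
    unfolding reflect_def by (rule imageI)
  then show "x \<in> reflect n S"
    by simp
qed (auto simp: reflect_def)

lemma reflect_reflect [simp]: "reflect n (reflect n S) = S"
  by (auto simp: mem_reflect)

lemma reflect_subset: "S \<subseteq> {0..int n} \<Longrightarrow> reflect n S \<subseteq> {0..int n}"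
  by (auto simp: reflect_def)

lemma mem_reflect_plus_reflect: "j \<in> reflect n S + reflect n S \<longleftrightarrow> 2 * int n - j \<in> S + S"
proof -
  have "j \<in> reflect n S + reflect n S \<longleftrightarrow> (\<exists>a b. a \<in> S \<and> b \<in> S \<and> j = (int n - a) + (int n - b))"
    by (auto simp: reflect_def set_plus_def)
  also have "\<dots> \<longleftrightarrow> (\<exists>a b. a \<in> S \<and> b \<in> S \<and> 2 * int n - j = a + b)"
    by (intro ex_cong1 conj_cong refl) linarith
  finally show ?thesis
    by (auto simp: set_plus_def)
qed

text \<open>A difference \<open>a - b\<close> at distance \<open>j\<close> from \<open>n\<close>
  satisfies \<open>j = b + (n - a)\<close>. Differences near the maximum thus become small mixed
  sums of the left fringe and the reflected right fringe.\<close>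

lemma mem_plus_reflect: "j \<in> S + reflect n S \<longleftrightarrow> int n - j \<in> diffset S"
proof -
  have "j \<in> S + reflect n S \<longleftrightarrow> (\<exists>a b. a \<in> S \<and> b \<in> S \<and> j = a + (int n - b))"
    by (auto simp: reflect_def set_plus_def)
  also have "\<dots> \<longleftrightarrow> (\<exists>a b. a \<in> S \<and> b \<in> S \<and> int n - j = b - a)"
    by (intro ex_cong1 conj_cong refl) linarith
  finally show ?thesis
    by (auto simp: diffset_def)
qed

lemma pr_reflect: "pr n (\<lambda>S. \<phi> (reflect n S)) = pr n \<phi>"
proof -
  have "bij_betw (reflect n) {S. S \<subseteq> {0..int n} \<and> \<phi> (reflect n S)} {S. S \<subseteq> {0..int n} \<and> \<phi> S}"
    by (rule bij_betw_byWitness[where f' = "reflect n"]) (auto dest: reflect_subset)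
  then show ?thesis
    by (simp add: pr_def bij_betw_same_card)
qed

lemma diff_in_diffset: "a \<in> S \<Longrightarrow> b \<in> S \<Longrightarrow> a - b \<in> diffset S"
  by (auto simp: diffset_def)

text \<open>The representations \<open>i + (j - i)\<close> with \<open>i < j / 2\<close> use
  disjoint pairs of points. For even \<open>j\<close> the midpoint is left out, so that both members
  of a pair are distinct; the number of pairs is still at least \<open>j / 2\<close>.\<close>

lemma pr_sum_missing_le:
  assumes "j \<le> n"
  shows "pr n (\<lambda>S. int j \<notin> S + S) \<le> q ^ j"
proof -
  define I where "I = {0..<(int j + 1) div 2}"
  have "j \<le> 2 * card I"
    by (simp add: I_def)
  have "pr n (\<lambda>S. int j \<notin> S + S) \<le> pr n (\<lambda>S. \<forall>i\<in>I. \<not> (i \<in> S \<and> int j - i \<in> S))"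
  proof (rule pr_mono, intro ballI notI)
    fix S i assume "int j \<notin> S + S" "i \<in> S \<and> int j - i \<in> S"
    then show False
      using set_plus_intro[of i S "int j - i" S] by simp
  qed
  also have "\<dots> \<le> q ^ j"
    by (rule pr_avoid_pairs_le) (use assms \<open>j \<le> 2 * card I\<close> in \<open>auto simp: I_def intro!: inj_onI\<close>)
  finally show ?thesis .
qed

text \<open>The pairs \<open>{i, i + d}\<close> form paths; a path splits into two matchings according to the parity of
  \<open>i div d\<close>, and the larger of the two contains at least half of the pairs.\<close>

lemma pr_diff_missing_le:
  assumes "d \<le> n"
  shows "pr n (\<lambda>S. int d \<notin> diffset S) \<le> q ^ (n + 1 - d)"
proof (cases "d = 0")
  case True
  \<comment> \<open>For \<open>d = 0\<close> the pairs degenerate. Only the empty set lacks the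
    difference 0, and \<open>1 / 2 \<le> q\<close> absorbs its probability.\<close>
  have "{S. S \<subseteq> {0..int n} \<and> 0 \<notin> diffset S} = {{}}"
    by (auto simp: diffset_def)
  then have "pr n (\<lambda>S. int d \<notin> diffset S) = (1 / 2) ^ (n + 1)"
    using True by (simp add: pr_def power_one_over)
  also have "\<dots> \<le> q ^ (n + 1)"
    using q_bounds by (intro power_mono) auto
  finally show ?thesis
    using True by simp
next
  case False
  define M where "M b = {i \<in> {0..int n - int d}. even (i div int d) = b}" for b
  have "M True \<union> M False = {0..int n - int d}" "M True \<inter> M False = {}"
    by (auto simp: M_def)
  moreover have "finite (M b)" for b
    by (rule finite_subset[of _ "{0..int n - int d}"]) (auto simp: M_def)
  ultimately have "card (M True) + card (M False) = card {0..int n - int d}"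
    by (metis card_Un_disjoint)
  also have "\<dots> = n + 1 - d"
    using assms by simp
  finally obtain b where b: "n + 1 - d \<le> 2 * card (M b)"
    by (cases "card (M True) \<le> card (M False)") (auto intro: that[of True] that[of False])
  have "pr n (\<lambda>S. int d \<notin> diffset S) \<le> pr n (\<lambda>S. \<forall>i\<in>M b. \<not> (i \<in> S \<and> i + int d \<in> S))"
  proof (rule pr_mono, intro ballI notI)
    fix S i assume "int d \<notin> diffset S" "i \<in> S \<and> i + int d \<in> S"
    then show False
      using diff_in_diffset[of "i + int d" S i] by simp
  qed
  also have "\<dots> \<le> q ^ (n + 1 - d)"
  proof (rule pr_avoid_pairs_le[OF _ _ _ _ b])
    \<comment> \<open>Shifting by \<open>d\<close> raises the quotient by one and flips its parity,
      so no pair starts where another pair of the same class ends.\<close>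
    have "(i + int d) div int d = i div int d + 1" for i
      using False by simp
    then show "M b \<inter> (\<lambda>i. i + int d) ` M b = {}"
      by (auto simp: M_def)
  qed (auto simp: M_def)
  finally show ?thesis .
qed

definition filled :: "nat \<Rightarrow> nat \<Rightarrow> int set \<Rightarrow> bool" where
  "filled k n S \<longleftrightarrow> {int k<..<2 * int n - int k} \<subseteq> S + S \<and> {0..<int n - int k} \<subseteq> diffset S"

text \<open>Three geometric tails give the factor 3: sums up to \<open>n\<close>, sums above
  \<open>n\<close> (by reflection these have the same probability), and differences.\<close>

lemma pr_not_filled_le: "pr n (\<lambda>S. \<not> filled k n S) \<le> 3 * q ^ (k + 1) / (1 - q)"
proof -
  let ?J = "{k<..n}" and ?D = "{..<n - k}"
  let ?A = "\<lambda>S. \<exists>j\<in>?J. int j \<notin> S + S"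
    and ?B = "\<lambda>S. \<exists>j\<in>?J. int j \<notin> reflect n S + reflect n S"
    and ?C = "\<lambda>S. \<exists>d\<in>?D. int d \<notin> diffset S"
  have "filled k n S" if "\<not> ?A S" "\<not> ?B S" "\<not> ?C S" for S
  proof -
    have "j \<in> S + S" if j: "int k < j" "j < 2 * int n - int k" for j
    proof (cases "j \<le> int n")
      case True
      then have "nat j \<in> ?J"
        using j by auto
      then have "int (nat j) \<in> S + S"
        using \<open>\<not> ?A S\<close> by blast
      then show ?thesis
        using j by simp
    next
      case False
      then have "nat (2 * int n - j) \<in> ?J"
        using j by auto
      then have "int (nat (2 * int n - j)) \<in> reflect n S + reflect n S"
        using \<open>\<not> ?B S\<close> by blast
      then show ?thesis
        using j by (simp add: mem_reflect_plus_reflect)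
    qed
    moreover have "d \<in> diffset S" if d: "0 \<le> d" "d < int n - int k" for d
    proof -
      have "nat d \<in> ?D"
        using d by auto
      then have "int (nat d) \<in> diffset S"
        using \<open>\<not> ?C S\<close> by blast
      then show ?thesis
        using d by simp
    qed
    ultimately show ?thesis
      by (auto simp: filled_def)
  qed
  then have "pr n (\<lambda>S. \<not> filled k n S) \<le> pr n (\<lambda>S. ?A S \<or> ?B S \<or> ?C S)"
    by (intro pr_mono) blast
  also have "\<dots> \<le> pr n ?A + (pr n ?B + pr n ?C)"
    using pr_disj_le[of n ?A "\<lambda>S. ?B S \<or> ?C S"] pr_disj_le[of n ?B ?C] by linarith
  also have "pr n ?B = pr n ?A"
    by (rule pr_reflect)
  also have "pr n ?A \<le> (\<Sum>j\<in>?J. q ^ j)"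
    by (rule order.trans[OF pr_bex_le]) (auto intro!: sum_mono pr_sum_missing_le)
  also have "\<dots> \<le> q ^ (k + 1) / (1 - q)"
    by (rule sum_q_power_le) auto
  also have "pr n ?C \<le> (\<Sum>d\<in>?D. q ^ (n + 1 - d))"
    by (rule order.trans[OF pr_bex_le]) (use pr_diff_missing_le in \<open>auto intro!: sum_mono\<close>)
  \<comment> \<open>For \<open>d < n - k\<close> the exponents \<open>n + 1 - d\<close> are distinct
    and at least \<open>k + 2\<close>, so the same tail bound applies.\<close>
  also have "\<dots> = (\<Sum>j\<in>(\<lambda>d. n + 1 - d) ` ?D. q ^ j)"
    by (subst sum.reindex) (auto intro!: inj_onI)
  also have "\<dots> \<le> q ^ (k + 1) / (1 - q)"
    by (rule sum_q_power_le) auto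
  finally show ?thesis
    by simp
qed

section \<open>Fringes and the limiting density\<close>

text \<open>\<open>A\<close> stands for the left fringe and \<open>B\<close> for the reflected right
  fringe. The terms count missing low sums, missing high sums, and missing large differences, the
  last doubled because differences come with both signs.\<close>

definition profile :: "nat \<Rightarrow> int set \<Rightarrow> int set \<Rightarrow> int \<times> int" where
  "profile k A B =
    (int (card ({0..int k} - (A + A)) + card ({0..int k} - (B + B))),
     2 * int (card ({0..int k} - (A + B))))"

text \<open>Nonnegative summands of a sum at most \<open>k\<close> are themselves at most
  \<open>k\<close>, so only the fringes matter.\<close>

lemma plus_Int_atLeastAtMost:
  fixes A B :: "int set"
  assumes "A \<subseteq> {0..}" "B \<subseteq> {0..}"
  shows "{0..k} - (A + B) = {0..k} - (A \<inter> {0..k} + B \<inter> {0..k})"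
proof -
  have "j \<in> A + B \<longleftrightarrow> j \<in> A \<inter> {0..k} + B \<inter> {0..k}" if "j \<le> k" for j
  proof
    assume "j \<in> A + B"
    then obtain a b where "a \<in> A" "b \<in> B" "j = a + b"
      by (auto elim: set_plus_elim)
    with assms that have "a \<in> A \<inter> {0..k}" "b \<in> B \<inter> {0..k}" "j = a + b"
      by fastforce+
    then show "j \<in> A \<inter> {0..k} + B \<inter> {0..k}"
      by auto
  qed (auto elim!: set_plus_elim)
  then show ?thesis
    by auto
qed

lemma profile_cong:
  assumes "A \<subseteq> {0..}" "B \<subseteq> {0..}" "A' \<subseteq> {0..}" "B' \<subseteq> {0..}"
    and "A \<inter> {0..int k} = A' \<inter> {0..int k}" "B \<inter> {0..int k} = B' \<inter> {0..int k}"
  shows "profile k A B = profile k A' B'"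
  unfolding profile_def
  using assms by (simp add: plus_Int_atLeastAtMost[of A A] plus_Int_atLeastAtMost[of B B]
      plus_Int_atLeastAtMost[of A B] plus_Int_atLeastAtMost[of A' A']
      plus_Int_atLeastAtMost[of B' B'] plus_Int_atLeastAtMost[of A' B'])

lemma diffset_uminus: "- d \<in> diffset S \<longleftrightarrow> d \<in> diffset S"
proof -
  have "d \<in> diffset S" if "- d \<in> diffset S" for d
  proof -
    obtain a b where ab: "a \<in> S" "b \<in> S" "- d = a - b"
      using \<open>- d \<in> diffset S\<close> by (auto simp: diffset_def)
    then have "d = b - a"
      by simp
    with ab show ?thesis
      using diff_in_diffset by simp
  qed
  from this[of d] this[of "- d"] show ?thesis
    by auto
qed

text \<open>In a filled set everything missing lies within \<open>k\<close> of an extreme value.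
  Reflection carries the upper sums, and both ends of the symmetric difference set, to the window
  \<open>{0..k}\<close>; \<open>k < n\<close> keeps the two ends disjoint, so their counts
  add.\<close>

lemma lam_eq_profile:
  assumes S: "S \<subseteq> {0..int n}" and filled: "filled k n S" and "k < n"
  shows "lam n S = profile k S (reflect n S)"
proof -
  let ?R = "reflect n S"
  let ?P = "{0..int k} - (S + S)" and ?Q = "{0..int k} - (?R + ?R)"
    and ?D = "{0..int k} - (S + ?R)"
  have sub: "S + S \<subseteq> {0..2 * int n}"
  proof
    fix x assume "x \<in> S + S"
    then obtain a b where "a \<in> S" "b \<in> S" "x = a + b"
      by (auto elim: set_plus_elim)
    moreover from this S have "a \<in> {0..int n}" "b \<in> {0..int n}"
      by auto
    ultimately show "x \<in> {0..2 * int n}"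
      by simp
  qed
  have "{0..2 * int n} - (S + S) = ?P \<union> (\<lambda>j. 2 * int n - j) ` ?Q"
  proof (intro equalityI subsetI)
    fix j assume j: "j \<in> {0..2 * int n} - (S + S)"
    then have "\<not> (int k < j \<and> j < 2 * int n - int k)"
      using filled by (auto simp: filled_def)
    then consider "j \<le> int k" | "2 * int n - int k \<le> j"
      by linarith
    then show "j \<in> ?P \<union> (\<lambda>j. 2 * int n - j) ` ?Q"
    proof cases
      case 2
      then have "2 * int n - j \<in> ?Q"
        using j by (simp add: mem_reflect_plus_reflect)
      then have "2 * int n - (2 * int n - j) \<in> (\<lambda>j. 2 * int n - j) ` ?Q"
        by (rule imageI)
      then show ?thesis
        by simp
    qed (use j in auto)
  qed (use \<open>k < n\<close> in \<open>auto simp: mem_reflect_plus_reflect\<close>)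
  moreover have "?P \<inter> (\<lambda>j. 2 * int n - j) ` ?Q = {}"
    using \<open>k < n\<close> by auto
  ultimately have "card ({0..2 * int n} - (S + S)) = card ?P + card ?Q"
    by (simp add: card_Un_disjoint card_image inj_on_def)
  moreover have "card (S + S) \<le> card {0..2 * int n}"
    by (intro card_mono sub) simp
  moreover have "finite (S + S)"
    using sub by (rule finite_subset) simp
  ultimately have sums: "2 * int n + 1 - int (card (S + S)) = int (card ?P + card ?Q)"
    using sub by (simp add: card_Diff_subset)
  have sub': "diffset S \<subseteq> {- int n..int n}"
  proof
    fix x assume "x \<in> diffset S"
    then obtain a b where "a \<in> S" "b \<in> S" "x = a - b"
      by (auto simp: diffset_def)
    moreover from this S have "a \<in> {0..int n}" "b \<in> {0..int n}"
      by auto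
    ultimately show "x \<in> {- int n..int n}"
      by simp
  qed
  have mid: "d \<in> diffset S" if "0 \<le> d \<and> d < int n - int k" for d
    using filled that by (auto simp: filled_def)
  have "{- int n..int n} - diffset S = (\<lambda>j. int n - j) ` ?D \<union> (\<lambda>j. j - int n) ` ?D"
  proof (intro equalityI subsetI)
    fix d assume d: "d \<in> {- int n..int n} - diffset S"
    then have "\<not> (0 \<le> d \<and> d < int n - int k)" "\<not> (0 \<le> - d \<and> - d < int n - int k)"
      using mid[of d] mid[of "- d"] diffset_uminus[of d S] by auto
    then consider "int n - int k \<le> d" | "int n - int k \<le> - d"
      by linarith
    then show "d \<in> (\<lambda>j. int n - j) ` ?D \<union> (\<lambda>j. j - int n) ` ?D"
    proof cases
      case 1
      then have "int n - d \<in> ?D"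
        using d by (simp add: mem_plus_reflect)
      then have "int n - (int n - d) \<in> (\<lambda>j. int n - j) ` ?D"
        by (rule imageI)
      then show ?thesis
        by simp
    next
      case 2
      then have "int n + d \<in> ?D"
        using d by (simp add: mem_plus_reflect diffset_uminus)
      then have "(int n + d) - int n \<in> (\<lambda>j. j - int n) ` ?D"
        by (rule imageI)
      then show ?thesis
        by simp
    qed
  next
    fix d assume "d \<in> (\<lambda>j. int n - j) ` ?D \<union> (\<lambda>j. j - int n) ` ?D"
    then obtain j where j: "j \<in> ?D" "d = int n - j \<or> d = - (int n - j)"
      by auto
    then have "int n - j \<notin> diffset S"
      by (simp add: mem_plus_reflect)
    then have "d \<notin> diffset S"
      using j(2) by (auto simp: diffset_uminus simp del: minus_diff_eq)
    then show "d \<in> {- int n..int n} - diffset S"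
      using j \<open>k < n\<close> by auto
  qed
  moreover have "(\<lambda>j. int n - j) ` ?D \<inter> (\<lambda>j. j - int n) ` ?D = {}"
    using \<open>k < n\<close> by auto
  ultimately have "card ({- int n..int n} - diffset S) = 2 * card ?D"
    by (simp add: card_Un_disjoint card_image inj_on_def)
  moreover have "card (diffset S) \<le> card {- int n..int n}"
    by (intro card_mono sub') simp
  moreover have "finite (diffset S)"
    using sub' by (rule finite_subset) simp
  ultimately have "2 * int n + 1 - int (card (diffset S)) = 2 * int (card ?D)"
    using sub' by (simp add: card_Diff_subset)
  with sums show ?thesis
    by (simp add: lam_def profile_def)
qed

lemma profile_fringe:
  assumes "S \<subseteq> {0..int n}"
  shows "profile k S (reflect n S) = profile k (S \<inter> {0..int k}) (reflect n S \<inter> {0..int k})"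
  using assms reflect_subset[OF assms] by (intro profile_cong) auto

lemma card_fringe_pairs:
  assumes "2 * k < n"
  defines "X \<equiv> {0..int k} \<union> {int n - int k..int n}"
  shows "card {S. S \<subseteq> X \<and> \<phi> (S \<inter> {0..int k}) (reflect n S \<inter> {0..int k})} =
    card {(A, B). A \<subseteq> {0..int k} \<and> B \<subseteq> {0..int k} \<and> \<phi> A B}"
proof (rule bij_betw_same_card)
  let ?K = "{0..int k}"
  have 1: "(A \<union> reflect n B) \<inter> ?K = A" "reflect n (A \<union> reflect n B) \<inter> ?K = B" if "A \<subseteq> ?K" "B \<subseteq> ?K" for A B
  proof -
    have "x \<notin> ?K" if "x \<in> reflect n B" for x
      using that \<open>B \<subseteq> ?K\<close> assms(1) by (fastforce simp: mem_reflect)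
    then show "(A \<union> reflect n B) \<inter> ?K = A"
      using \<open>A \<subseteq> ?K\<close> by blast
    have "x \<notin> ?K" if "int n - x \<in> A" for x
      using that \<open>A \<subseteq> ?K\<close> assms(1) by fastforce
    then show "reflect n (A \<union> reflect n B) \<inter> ?K = B"
      using \<open>B \<subseteq> ?K\<close> by (auto simp: mem_reflect)
  qed
  have 3: "A \<subseteq> X" "reflect n A \<subseteq> X" if "A \<subseteq> ?K" for A
    using that by (auto simp: X_def reflect_def)
  have 2: "(S \<inter> ?K) \<union> reflect n (reflect n S \<inter> ?K) = S" if "S \<subseteq> X" for S
    using that by (fastforce simp: X_def mem_reflect)
  show "bij_betw (\<lambda>S. (S \<inter> ?K, reflect n S \<inter> ?K))
    {S. S \<subseteq> X \<and> \<phi> (S \<inter> ?K) (reflect n S \<inter> ?K)} {(A, B). A \<subseteq> ?K \<and> B \<subseteq> ?K \<and> \<phi> A B}"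
    by (rule bij_betw_byWitness[where f' = "\<lambda>(A, B). A \<union> reflect n B"]) (use 3 in \<open>auto simp: 1 2\<close>)
qed

text \<open>For \<open>2 * k < n\<close> the two fringes are disjoint, hence a uniform pair of
  subsets of \<open>{0..k}\<close>. The value is free of \<open>n\<close>, which is what makes the
  density converge.\<close>

lemma pr_fringe:
  assumes "2 * k < n"
  shows "pr n (\<lambda>S. \<phi> (S \<inter> {0..int k}) (reflect n S \<inter> {0..int k})) =
    card {(A, B). A \<subseteq> {0..int k} \<and> B \<subseteq> {0..int k} \<and> \<phi> A B} / 4 ^ (k + 1)"
proof -
  let ?K = "{0..int k}"
  define X where "X = ?K \<union> {int n - int k..int n}"
  have X: "X \<subseteq> {0..int n}"
    using assms by (auto simp: X_def)
  have "card X = 2 * (k + 1)"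
    unfolding X_def using assms by (subst card_Un_disjoint) auto
  then have c: "card ({0..int n} - X) + 2 * (k + 1) = n + 1"
    using card_mono[OF _ X] X by (simp add: card_Diff_subset finite_subset)
  have "S \<inter> X \<inter> ?K = S \<inter> ?K" "reflect n (S \<inter> X) \<inter> ?K = reflect n S \<inter> ?K" for S
    by (auto simp: X_def mem_reflect)
  then have "card {S. S \<subseteq> {0..int n} \<and> \<phi> (S \<inter> ?K) (reflect n S \<inter> ?K)} =
      card {S. S \<subseteq> X \<and> \<phi> (S \<inter> ?K) (reflect n S \<inter> ?K)} * 2 ^ card ({0..int n} - X)"
    using card_subsets_split[OF _ X, of "\<lambda>S. \<phi> (S \<inter> ?K) (reflect n S \<inter> ?K)" "\<lambda>_. True"]
    by (simp add: card_Pow flip: Pow_def)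
  moreover have "card {S. S \<subseteq> X \<and> \<phi> (S \<inter> ?K) (reflect n S \<inter> ?K)} =
      card {(A, B). A \<subseteq> ?K \<and> B \<subseteq> ?K \<and> \<phi> A B}"
    unfolding X_def by (rule card_fringe_pairs[OF assms])
  moreover have "(2::real) ^ (n + 1) = 2 ^ card ({0..int n} - X) * 4 ^ (k + 1)"
    unfolding c[symmetric] power_add power_mult by simp
  ultimately show ?thesis
    unfolding pr_def by simp
qed

lemma pr_lam_profile_le:
  assumes "k < n"
  shows "\<bar>pr n (\<lambda>S. \<phi> S \<and> lam n S \<in> L) - pr n (\<lambda>S. \<phi> S \<and> profile k S (reflect n S) \<in> L)\<bar>
    \<le> 3 * q ^ (k + 1) / (1 - q)"
  by (rule order.trans[OF pr_diff_le pr_not_filled_le]) (use lam_eq_profile assms in auto)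

lemma q_tail_small:
  assumes "0 < e"
  shows "\<exists>k\<ge>k0. 3 * q ^ (k + 1) / (1 - q) \<le> e"
proof -
  have "(\<lambda>k. 3 * q ^ (k + 1) / (1 - q)) \<longlonglongrightarrow> 3 * 0 / (1 - q)"
    using q_bounds by (intro tendsto_intros LIMSEQ_ignore_initial_segment LIMSEQ_power_zero) auto
  then have "\<forall>\<^sub>F k in sequentially. 3 * q ^ (k + 1) / (1 - q) < e"
    using assms by (intro order_tendstoD(2)) auto
  then have "\<forall>\<^sub>F k in sequentially. k0 \<le> k \<and> 3 * q ^ (k + 1) / (1 - q) < e"
    using eventually_ge_at_top[of k0] by eventually_elim auto
  then have "\<exists>k. k0 \<le> k \<and> 3 * q ^ (k + 1) / (1 - q) < e"
    by (rule eventually_happens'[OF sequentially_bot])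
  then show ?thesis
    by (auto intro: less_imp_le)
qed

text \<open>For all \<open>n > 2 * k\<close> the probability lies within a small tail of one
  constant \<open>c\<close>, which depends on \<open>k\<close> only; hence the sequence is Cauchy.
  This also justifies the use of \<open>lim\<close> in \<open>rho\<close>.\<close>

lemma pr_lam_tendsto_rho: "(\<lambda>n. pr n (\<lambda>S. lam n S \<in> L)) \<longlonglongrightarrow> rho L"
proof -
  let ?p = "\<lambda>n. pr n (\<lambda>S. lam n S \<in> L)"
  have "Cauchy ?p"
  proof (rule metric_CauchyI)
    fix e :: real assume "0 < e"
    then obtain k where k: "3 * q ^ (k + 1) / (1 - q) \<le> e / 3"
      using q_tail_small[of "e / 3" 0] by auto
    define c where
      "c = card {(A, B). A \<subseteq> {0..int k} \<and> B \<subseteq> {0..int k} \<and> profile k A B \<in> L} / 4 ^ (k + 1)"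
    have near: "\<bar>?p n - c\<bar> \<le> e / 3" if "2 * k < n" for n
    proof -
      have "pr n (\<lambda>S. profile k S (reflect n S) \<in> L) = c"
        unfolding c_def pr_fringe[OF that, symmetric] by (rule pr_cong) (simp add: profile_fringe)
      then show ?thesis
        using pr_lam_profile_le[of k n "\<lambda>_. True" L] that k by simp
    qed
    then have "\<bar>?p m - ?p n\<bar> < e" if "m \<ge> 2 * k + 1" "n \<ge> 2 * k + 1" for m n
      using near[of m] near[of n] that \<open>0 < e\<close> by linarith
    then show "\<exists>M. \<forall>m\<ge>M. \<forall>n\<ge>M. dist (?p m) (?p n) < e"
      unfolding dist_real_def by blast
  qed
  then have "?p \<longlonglongrightarrow> lim ?p"
    by (simp add: Cauchy_convergent_iff convergent_LIMSEQ_iff)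
  moreover have "rho L = lim ?p"
    by (simp add: rho_def pr_def)
  ultimately show ?thesis
    by simp
qed

text \<open>With \<open>profile\<close> in place of \<open>lam\<close> the condition lives on the
  fringes, so the middle event factors out exactly. Replacing \<open>lam\<close> by
  \<open>profile\<close> in each of the two terms costs one tail bound, hence 6 instead of
  3.\<close>

lemma fringe_decoupling:
  fixes E F :: "int set \<Rightarrow> bool"
  assumes "2 * k < n"
    and E: "depends_only_on n {int k + 1..int n - int k - 1} E"
    and F: "depends_only_on n ({0..int k} \<union> {int n - int k..int n}) F"
  shows "\<bar>pr n (\<lambda>S. (E S \<and> F S) \<and> lam n S \<in> L) - pr n E * pr n (\<lambda>S. F S \<and> lam n S \<in> L)\<bar>
    \<le> 6 * q ^ (k + 1) / (1 - q)"
proof -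
  let ?X = "{int k + 1..int n - int k - 1}" and ?L' = "\<lambda>S. profile k S (reflect n S) \<in> L"
  let ?t = "3 * q ^ (k + 1) / (1 - q)"
  have Y: "{0..int k} \<union> {int n - int k..int n} = {0..int n} - ?X"
    using assms(1) by auto
  have "?L' S \<longleftrightarrow> ?L' T"
    if "S \<subseteq> {0..int n}" "T \<subseteq> {0..int n}" and eq: "S \<inter> ({0..int n} - ?X) = T \<inter> ({0..int n} - ?X)" for S T
  proof -
    have mem: "x \<in> S \<longleftrightarrow> x \<in> T" if "x \<in> {0..int k} \<union> {int n - int k..int n}" for x
      using eq that unfolding Y[symmetric] by blast
    have "S \<inter> {0..int k} = T \<inter> {0..int k}"
      using mem by blast
    moreover have "reflect n S \<inter> {0..int k} = reflect n T \<inter> {0..int k}"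
      using mem by (auto simp: mem_reflect)
    ultimately show ?thesis
      using that by (simp add: profile_fringe)
  qed
  then have "depends_only_on n ({0..int n} - ?X) (\<lambda>S. F S \<and> ?L' S)"
    using F unfolding Y depends_only_on_def by blast
  then have "pr n (\<lambda>S. E S \<and> (F S \<and> ?L' S)) = pr n E * pr n (\<lambda>S. F S \<and> ?L' S)"
    using assms(1) by (intro pr_indep[OF E]) auto
  moreover have "\<bar>pr n (\<lambda>S. (E S \<and> F S) \<and> lam n S \<in> L) - pr n (\<lambda>S. E S \<and> F S \<and> ?L' S)\<bar> \<le> ?t"
    using pr_lam_profile_le[of k n "\<lambda>S. E S \<and> F S" L] assms(1) by (simp add: conj_assoc)
  moreover have "\<bar>pr n E * pr n (\<lambda>S. F S \<and> lam n S \<in> L) - pr n E * pr n (\<lambda>S. F S \<and> ?L' S)\<bar> \<le> ?t"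
  proof -
    have "pr n E \<le> 1"
      using pr_mono[of n E "\<lambda>_. True"] by (simp add: pr_True)
    then have "pr n E * \<bar>pr n (\<lambda>S. F S \<and> lam n S \<in> L) - pr n (\<lambda>S. F S \<and> ?L' S)\<bar> \<le> 1 * ?t"
      using assms(1) by (intro mult_mono pr_lam_profile_le) (auto simp: pr_nonneg)
    then show ?thesis
      by (simp add: pr_nonneg abs_mult flip: right_diff_distrib)
  qed
  ultimately show ?thesis
    by linarith
qed

section \<open>Positivity of the density\<close>

text \<open>Beyond missing nothing, the set contains solid blocks at both ends. These later bridge
  the gap between a glued fringe and the middle.\<close>

definition full :: "nat \<Rightarrow> nat \<Rightarrow> int set \<Rightarrow> bool" where
  "full M n T \<longleftrightarrow> T \<subseteq> {0..int n} \<and> {0..int M} \<union> {int n - int M..int n} \<subseteq> T \<and>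
    {0..2 * int n} \<subseteq> T + T \<and> {0..int n} \<subseteq> diffset T"

lemma full_subset: "full M n T \<Longrightarrow> T \<subseteq> {0..int n}"
  by (simp add: full_def)

lemma full_union_ends:
  assumes T: "T \<subseteq> {0..int n}" "filled m n T" and "M \<le> m" "m \<le> n"
  defines "E \<equiv> {0..int m} \<union> {int n - int m..int n}"
  shows "full M n (T \<union> E)"
proof -
  let ?T = "T \<union> E"
  have ends: "x \<in> ?T" if "0 \<le> x \<and> x \<le> int m \<or> int n - int m \<le> x \<and> x \<le> int n" for x
    using that by (auto simp: E_def)
  have "j \<in> ?T + ?T" if j: "0 \<le> j" "j \<le> 2 * int n" for j
  proof -
    consider "j \<le> int m" | "int m < j" "j < 2 * int n - int m" | "2 * int n - int m \<le> j"
      by linarith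
    then show ?thesis
    proof cases
      case 1
      then show ?thesis
        using set_plus_intro[OF ends[of 0] ends[of j]] j by simp
    next
      case 2
      then have "j \<in> T + T"
        using T(2) by (auto simp: filled_def)
      then show ?thesis
        by (auto elim!: set_plus_elim)
    next
      case 3
      then show ?thesis
        using set_plus_intro[OF ends[of "int n"] ends[of "j - int n"]] j \<open>m \<le> n\<close> by simp
    qed
  qed
  moreover have "d \<in> diffset ?T" if d: "0 \<le> d" "d \<le> int n" for d
  proof (cases "d < int n - int m")
    case True
    then have "d \<in> diffset T"
      using T(2) d by (auto simp: filled_def)
    then show ?thesis
      by (auto simp: diffset_def)
  next
    case False
    then show ?thesis
      using diff_in_diffset[OF ends[of d] ends[of 0]] d by simp
  qed
  ultimately show ?thesis
    using assms by (auto simp: full_def)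
qed

text \<open>At least half of all sets are filled for a suitable \<open>m\<close>, and adding two end
  blocks makes them full. Only the points of the blocks are overwritten, so the proportion drops by
  a factor that does not depend on \<open>n\<close>.\<close>

lemma pr_full_pos: "\<exists>c>0. \<exists>N. \<forall>n\<ge>N. c \<le> pr n (full M n)"
proof -
  obtain m where m: "M \<le> m" "3 * q ^ (m + 1) / (1 - q) \<le> 1 / 2"
    using q_tail_small[of "1 / 2" M] by auto
  have "1 / 2 / 4 ^ (m + 1) \<le> pr n (full M n)" if "m \<le> n" for n
  proof -
    let ?E = "{0..int m} \<union> {int n - int m..int n}"
    let ?G = "{T. T \<subseteq> {0..int n} \<and> filled m n T}" and ?H = "{T. T \<subseteq> {0..int n} \<and> full M n T}"
    have "1 \<le> pr n (\<lambda>S. filled m n S \<or> \<not> filled m n S)"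
      by (simp add: pr_True)
    also have "\<dots> \<le> pr n (filled m n) + pr n (\<lambda>S. \<not> filled m n S)"
      by (rule pr_disj_le)
    also have "pr n (\<lambda>S. \<not> filled m n S) \<le> 1 / 2"
      using pr_not_filled_le[of n m] m(2) by linarith
    finally have half: "1 / 2 \<le> pr n (filled m n)"
      by linarith
    have "card ?E \<le> 2 * (m + 1)"
      by (rule order.trans[OF card_Un_le]) simp
    \<comment> \<open>The trace on \<open>?E\<close> restores what the union forgets.\<close>
    have "inj_on (\<lambda>T. (T \<union> ?E, T \<inter> ?E)) ?G"
      by (rule inj_onI) blast
    moreover have "(\<lambda>T. (T \<union> ?E, T \<inter> ?E)) ` ?G \<subseteq> ?H \<times> Pow ?E"
    proof (rule image_subsetI)
      fix T assume "T \<in> ?G"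
      then have "full M n (T \<union> ?E)"
        using full_union_ends[OF _ _ m(1) that] by simp
      with full_subset[OF this] show "(T \<union> ?E, T \<inter> ?E) \<in> ?H \<times> Pow ?E"
        by simp
    qed
    ultimately have "card ?G \<le> card (?H \<times> Pow ?E)"
      by (intro card_inj_on_le[where f = "\<lambda>T. (T \<union> ?E, T \<inter> ?E)"] finite_cartesian_product) auto
    also have "\<dots> = card ?H * 2 ^ card ?E"
      by (simp add: card_cartesian_product card_Pow)
    also have "\<dots> \<le> card ?H * 2 ^ (2 * (m + 1))"
      using \<open>card ?E \<le> 2 * (m + 1)\<close> by (intro mult_left_mono power_increasing) auto
    also have "\<dots> = card ?H * 4 ^ (m + 1)"
      unfolding power_mult by simp
    finally have "real (card ?G) \<le> real (card ?H * 4 ^ (m + 1))"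
      by (rule of_nat_mono)
    then have "real (card ?G) / 2 ^ (n + 1) \<le> real (card ?H * 4 ^ (m + 1)) / 2 ^ (n + 1)"
      by (rule divide_right_mono) simp
    then have "pr n (filled m n) \<le> pr n (full M n) * 4 ^ (m + 1)"
      by (simp add: pr_def)
    with half show ?thesis
      by (simp add: field_simps)
  qed
  then show ?thesis
    by (intro exI[of _ "1 / 2 / 4 ^ (m + 1)"]) auto
qed

text \<open>Injectivity turns the positive density of full sets into a positive density of sets with
  \<open>lam = v\<close>.\<close>

definition realizable :: "int \<times> int \<Rightarrow> bool" where
  "realizable v \<longleftrightarrow> (\<exists>K M N. \<exists>f :: nat \<Rightarrow> int set \<Rightarrow> int set. \<forall>n\<ge>N.
    inj_on (f n) {T. full M n T} \<and>
    (\<forall>T. full M n T \<longrightarrow> f n T \<subseteq> {0..int (n + K)} \<and> lam (n + K) (f n T) = v))"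

lemma realizableI:
  assumes "\<And>n. n \<ge> N \<Longrightarrow> inj_on (f n) {T. full M n T}"
    and "\<And>n T. n \<ge> N \<Longrightarrow> full M n T \<Longrightarrow> f n T \<subseteq> {0..int (n + K)}"
    and "\<And>n T. n \<ge> N \<Longrightarrow> full M n T \<Longrightarrow> lam (n + K) (f n T) = v"
  shows "realizable v"
  unfolding realizable_def
  by (rule exI[of _ K], rule exI[of _ M], rule exI[of _ N], rule exI[of _ f]) (use assms in blast)

text \<open>The map embeds the full sets of length \<open>n\<close> into sets of length
  \<open>n + K\<close> with \<open>lam = v\<close>, so their density survives up to the factor
  \<open>2 ^ K\<close>.\<close>

lemma rho_pos:
  assumes "realizable v" "v \<in> L"
  shows "0 < rho L"
proof -
  obtain K M N and f :: "nat \<Rightarrow> int set \<Rightarrow> int set" where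
    f: "\<And>n. n \<ge> N \<Longrightarrow> inj_on (f n) {T. full M n T}"
      "\<And>n T. n \<ge> N \<Longrightarrow> full M n T \<Longrightarrow> f n T \<subseteq> {0..int (n + K)} \<and> lam (n + K) (f n T) = v"
    using assms(1) unfolding realizable_def by blast
  obtain c N' where c: "0 < c" "\<And>n. n \<ge> N' \<Longrightarrow> c \<le> pr n (full M n)"
    using pr_full_pos[of M] by blast
  have "c / 2 ^ K \<le> pr n (\<lambda>S. lam n S \<in> L)" if n: "n \<ge> max N N' + K" for n
  proof -
    define n' where "n' = n - K"
    have n': "n = n' + K" "n' \<ge> N" "n' \<ge> N'"
      using n by (auto simp: n'_def)
    have "card {T. T \<subseteq> {0..int n'} \<and> full M n' T} \<le> card {S. S \<subseteq> {0..int n} \<and> lam n S \<in> L}"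
    proof (rule card_inj_on_le[where f = "f n'"])
      show "inj_on (f n') {T. T \<subseteq> {0..int n'} \<and> full M n' T}"
        by (rule inj_on_subset[OF f(1)[OF n'(2)]]) auto
      show "f n' ` {T. T \<subseteq> {0..int n'} \<and> full M n' T} \<subseteq> {S. S \<subseteq> {0..int n} \<and> lam n S \<in> L}"
        using f(2)[OF n'(2)] assms(2) unfolding n'(1) by auto
    qed simp
    then have "pr n' (full M n') / 2 ^ K \<le> pr n (\<lambda>S. lam n S \<in> L)"
      unfolding pr_def n'(1) by (simp add: power_add divide_right_mono mult.assoc)
    moreover have "c / 2 ^ K \<le> pr n' (full M n') / 2 ^ K"
      using c(2)[OF n'(3)] by (intro divide_right_mono) auto
    ultimately show ?thesis
      by linarith
  qed
  then have "c / 2 ^ K \<le> rho L"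
    by (intro LIMSEQ_le_const[OF pr_lam_tendsto_rho]) blast
  moreover have "0 < c / 2 ^ K"
    using c(1) by simp
  ultimately show ?thesis
    by linarith
qed

text \<open>A shift preserves both cardinalities, while the longer interval raises
  \<open>2 * n + 1\<close> by 2.\<close>

lemma lam_translate: "lam (n + 1) ((\<lambda>x. x + 1) ` S) = lam n S + (2, 2)"
proof -
  have "(\<lambda>x. x + 1) ` S + (\<lambda>x. x + 1) ` S = (\<lambda>x. x + 2) ` (S + S)"
  proof (intro equalityI subsetI)
    fix x assume "x \<in> (\<lambda>x. x + 1) ` S + (\<lambda>x. x + 1) ` S"
    then obtain a b where "a \<in> S" "b \<in> S" "x = (a + 1) + (b + 1)"
      by (auto elim!: set_plus_elim)
    then have "a + b \<in> S + S" "x = (a + b) + 2"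
      by auto
    then show "x \<in> (\<lambda>x. x + 2) ` (S + S)"
      by (rule rev_image_eqI)
  next
    fix x assume "x \<in> (\<lambda>x. x + 2) ` (S + S)"
    then obtain a b where "a \<in> S" "b \<in> S" "x = (a + 1) + (b + 1)"
      by (auto elim!: set_plus_elim)
    then show "x \<in> (\<lambda>x. x + 1) ` S + (\<lambda>x. x + 1) ` S"
      by (simp only:) (intro set_plus_intro imageI)
  qed
  then have "card ((\<lambda>x. x + 1) ` S + (\<lambda>x. x + 1) ` S) = card (S + S)"
    by (simp add: card_image)
  moreover have "diffset ((\<lambda>x. x + 1) ` S) = diffset S"
  proof (intro equalityI subsetI)
    fix x assume "x \<in> diffset S"
    then obtain a b where "a \<in> S" "b \<in> S" "x = (a + 1) - (b + 1)"
      by (auto simp: diffset_def)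
    then show "x \<in> diffset ((\<lambda>x. x + 1) ` S)"
      by (simp only:) (intro diff_in_diffset imageI)
  next
    fix x assume "x \<in> diffset ((\<lambda>x. x + 1) ` S)"
    then obtain a b where "a \<in> S" "b \<in> S" "x = a - b"
      by (auto simp: diffset_def)
    then show "x \<in> diffset S"
      by (simp add: diff_in_diffset)
  qed
  ultimately show ?thesis
    by (simp add: lam_def)
qed

lemma realizable_translate:
  assumes "realizable v"
  shows "realizable (v + (2, 2))"
proof -
  obtain K M N and f :: "nat \<Rightarrow> int set \<Rightarrow> int set" where
    f: "\<And>n. n \<ge> N \<Longrightarrow> inj_on (f n) {T. full M n T}"
      "\<And>n T. n \<ge> N \<Longrightarrow> full M n T \<Longrightarrow> f n T \<subseteq> {0..int (n + K)} \<and> lam (n + K) (f n T) = v"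
    using assms unfolding realizable_def by blast
  show ?thesis
  proof (rule realizableI)
    show "inj_on (\<lambda>T. (\<lambda>x. x + 1) ` f n T) {T. full M n T}" if "n \<ge> N" for n
      using f(1)[OF that] by (simp add: inj_on_def inj_image_eq_iff)
    show "(\<lambda>x. x + 1) ` f n T \<subseteq> {0..int (n + (K + 1))}" if "n \<ge> N" "full M n T" for n T
      using f(2)[OF that] by auto
    show "lam (n + (K + 1)) ((\<lambda>x. x + 1) ` f n T) = v + (2, 2)" if "n \<ge> N" "full M n T" for n T
      using f(2)[OF that] lam_translate[of "n + K" "f n T"] by simp
  qed
qed

section \<open>Gluing prescribed fringes to a full set\<close>

definition extend :: "nat \<Rightarrow> int set \<Rightarrow> int set \<Rightarrow> nat \<Rightarrow> int set \<Rightarrow> int set" where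
  "extend K A B n T = A \<union> (\<lambda>x. int K + x) ` T \<union> reflect (n + 2 * K) B"

lemma mem_extend:
  "x \<in> extend K A B n T \<longleftrightarrow> x \<in> A \<or> x - int K \<in> T \<or> int n + 2 * int K - x \<in> B"
proof -
  have "x \<in> (\<lambda>x. int K + x) ` T \<longleftrightarrow> x - int K \<in> T"
    by (auto intro: rev_image_eqI[of "x - int K"])
  then show ?thesis
    by (auto simp: extend_def mem_reflect)
qed

text \<open>Since \<open>T\<close> loses nothing, its shifted copy yields the central sums and the
  differences up to \<open>n\<close>. The sums near the ends and the larger differences use the
  point 0 of \<open>A\<close> or \<open>B\<close> together with an end block of \<open>T\<close>. So
  the set is filled with parameter \<open>K - 1\<close>, and below \<open>K\<close> only
  \<open>A\<close> and \<open>B\<close> are visible.\<close>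

lemma lam_extend:
  assumes A: "A \<subseteq> {0..<int K}" "0 \<in> A" and B: "B \<subseteq> {0..<int K}" "0 \<in> B" and T: "full K n T"
  shows "lam (n + 2 * K) (extend K A B n T) = profile (K - 1) A B"
proof -
  let ?S = "extend K A B n T" and ?N = "n + 2 * K"
  let ?R = "reflect ?N ?S"
  have "K > 0"
    using A by auto
  have T_bounds: "0 \<le> x \<and> x \<le> int n" if "x \<in> T" for x
    using that T by (auto simp: full_def)
  have A_bounds: "0 \<le> x \<and> x < int K" if "x \<in> A" for x
    using that A by auto
  have B_bounds: "0 \<le> x \<and> x < int K" if "x \<in> B" for x
    using that B by auto
  have S: "?S \<subseteq> {0..int ?N}"
    using T_bounds A_bounds B_bounds by (fastforce simp: mem_extend)
  have mem_R: "x \<in> ?R \<longleftrightarrow> x \<in> B \<or> int n + int K - x \<in> T \<or> int n + 2 * int K - x \<in> A" for x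
    by (auto simp: mem_reflect mem_extend algebra_simps)
  have zero: "0 \<in> ?S" "0 \<in> ?R"
    using A B by (auto simp: mem_extend mem_R)
  have T_ends: "x \<in> T" if "0 \<le> x \<and> x \<le> int K \<or> int n - int K \<le> x \<and> x \<le> int n" for x
    using T that by (auto simp: full_def)
  have "j \<in> ?S + ?S" if j: "int K \<le> j" "j \<le> 2 * int ?N - int K" for j
  proof -
    consider "j \<le> 2 * int K" | "2 * int K < j" "j \<le> 2 * int n + 2 * int K"
      | "2 * int n + 2 * int K < j"
      by linarith
    then show ?thesis
    proof cases
      case 1
      then have "j \<in> ?S"
        using T_ends[of "j - int K"] j by (simp add: mem_extend)
      then show ?thesis
        using set_plus_intro[OF zero(1)] by fastforce
    next
      case 2
      then have "j - 2 * int K \<in> T + T"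
        using T by (auto simp: full_def)
      then obtain a b where ab: "a \<in> T" "b \<in> T" "j - 2 * int K = a + b"
        by (auto elim: set_plus_elim)
      then have "(int K + a) + (int K + b) \<in> ?S + ?S"
        by (intro set_plus_intro) (auto simp: mem_extend)
      then show ?thesis
        using ab(3) by (simp add: algebra_simps)
    next
      case 3
      then have "2 * int ?N - j \<in> ?R"
        using T_ends[of "int n + int K - (2 * int ?N - j)"] j by (simp add: mem_R)
      then have "0 + (2 * int ?N - j) \<in> ?R + ?R"
        by (rule set_plus_intro[OF zero(2)])
      then show ?thesis
        unfolding mem_reflect_plus_reflect by simp
    qed
  qed
  moreover have "d \<in> diffset ?S" if d: "0 \<le> d" "d \<le> int ?N - int K" for d
  proof (cases "d \<le> int n")
    case True
    then have "d \<in> diffset T"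
      using T d by (auto simp: full_def)
    then obtain a b where ab: "a \<in> T" "b \<in> T" "d = a - b"
      by (auto simp: diffset_def)
    then have "(int K + a) - (int K + b) \<in> diffset ?S"
      by (intro diff_in_diffset) (auto simp: mem_extend)
    then show ?thesis
      using ab(3) by simp
  next
    case False
    then have "d \<in> ?S"
      using T_ends[of "d - int K"] d by (simp add: mem_extend)
    then show ?thesis
      using diff_in_diffset[OF _ zero(1)] by fastforce
  qed
  ultimately have "filled (K - 1) ?N ?S"
    using \<open>K > 0\<close> by (auto simp: filled_def of_nat_diff)
  then have "lam ?N ?S = profile (K - 1) ?S ?R"
    using \<open>K > 0\<close> by (intro lam_eq_profile[OF S]) auto
  also have "\<dots> = profile (K - 1) A B"
  proof (rule profile_cong)
    have low: "x \<in> ?S \<longleftrightarrow> x \<in> A" "x \<in> ?R \<longleftrightarrow> x \<in> B" if "x < int K" for x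
      using that T_bounds[of "x - int K"] B_bounds[of "int n + 2 * int K - x"]
        T_bounds[of "int n + int K - x"] A_bounds[of "int n + 2 * int K - x"]
      by (auto simp: mem_extend mem_R)
    then show "?S \<inter> {0..int (K - 1)} = A \<inter> {0..int (K - 1)}"
      "?R \<inter> {0..int (K - 1)} = B \<inter> {0..int (K - 1)}"
      using \<open>K > 0\<close> by (auto simp: of_nat_diff)
    show "?S \<subseteq> {0..}" "?R \<subseteq> {0..}"
      using S reflect_subset[OF S] by auto
  qed (use A B in auto)
  finally show ?thesis .
qed

lemma realizable_profile:
  assumes A: "A \<subseteq> {0..<int K}" "0 \<in> A" and B: "B \<subseteq> {0..<int K}" "0 \<in> B"
  shows "realizable (profile (K - 1) A B)"
proof -
  show ?thesis
  proof (rule realizableI)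
    \<comment> \<open>\<open>A\<close> lies below the window of the shifted \<open>T\<close> and the
      reflected \<open>B\<close> above it, so \<open>T\<close> can be read off.\<close>
    have rec: "T = {x \<in> {0..int n}. int K + x \<in> extend K A B n T}" if "full K n T" for n T
    proof -
      have "T \<subseteq> {0..int n}"
        using that by (rule full_subset)
      then show ?thesis
        using A B by (auto simp: mem_extend)
    qed
    show "inj_on (extend K A B n) {T. full K n T}" if "n \<ge> 0" for n
    proof (rule inj_onI, unfold mem_Collect_eq)
      fix T T' assume "full K n T" "full K n T'" "extend K A B n T = extend K A B n T'"
      then show "T = T'"
        using rec[of n T] rec[of n T'] by simp
    qed
    show "extend K A B n T \<subseteq> {0..int (n + 2 * K)}" if "full K n T" for n T
    proof -
      have "T \<subseteq> {0..int n}"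
        using that by (rule full_subset)
      then show ?thesis
        using A B by (fastforce simp: extend_def reflect_def)
    qed
  qed (rule lam_extend[OF assms])
qed

text \<open>With fringes \<open>{0}\<close> and \<open>{0..s}\<close> only the sums
  \<open>1, ..., s\<close> of the first fringe with itself are lost.\<close>

lemma realizable_no_difference: "realizable (int s, 0)"
proof -
  let ?A = "{0::int}" and ?B = "{0..int s}"
  have "?A + ?A = {0}" "?A + ?B = ?B"
    by (auto simp: set_plus_def)
  moreover have "j \<in> ?B + ?B" if "j \<in> ?B" for j
    using that set_plus_intro[of 0 ?B j ?B] by simp
  then have "{0..int s} - (?B + ?B) = {}"
    by blast
  moreover have "{0..int s} - {0} = {1..int s}"
    by auto
  ultimately have "profile s ?A ?B = (int s, 0)"
    by (simp add: profile_def)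
  moreover have "?A \<subseteq> {0..<int (s + 1)}" "?B \<subseteq> {0..<int (s + 1)}"
    by auto
  ultimately show ?thesis
    using realizable_profile[of ?A "s + 1" ?B] by simp
qed

section \<open>Periodic fringes modulo 8\<close>

definition periodic :: "nat \<Rightarrow> int set \<Rightarrow> int set" where
  "periodic e P = {x \<in> {0..<8 * int e}. x mod 8 \<in> P}"

text \<open>A sum of residues without carry allows \<open>p\<close> to be taken from the first
  period and \<open>j - p\<close> from the period of \<open>j\<close>. It therefore works even in
  the first period.\<close>

lemma mem_periodic_plus:
  assumes j: "j \<in> {0..<8 * int e}"
    and "\<exists>p\<in>P. 0 \<le> p \<and> p \<le> j mod 8 \<and> j mod 8 - p \<in> Q"
  shows "j \<in> periodic e P + periodic e Q"
proof -
  obtain p where p: "p \<in> P" "0 \<le> p" "p \<le> j mod 8" "j mod 8 - p \<in> Q"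
    using assms(2) by blast
  have "j mod 8 < 8" "j mod 8 \<le> j"
    using j by (auto intro: zmod_le_nonneg_dividend)
  then have "p < 8" "p \<le> j"
    using p(3) by linarith+
  have "(j - p) mod 8 = (j mod 8 - p) mod 8"
    by (simp add: mod_diff_left_eq)
  also have "\<dots> = j mod 8 - p"
    using p(2,3) \<open>j mod 8 < 8\<close> by (intro mod_pos_pos_trivial) linarith+
  finally have "p \<in> periodic e P" "j - p \<in> periodic e Q"
    using j p \<open>p < 8\<close> \<open>p \<le> j\<close> by (auto simp: periodic_def)
  then have "p + (j - p) \<in> periodic e P + periodic e Q"
    by (rule set_plus_intro)
  then show ?thesis
    by simp
qed

lemma card_mod_8_eq:
  assumes "0 \<le> c" "c < 8"
  shows "card {j \<in> {0..<8 * int e}. j mod 8 = c} = e"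
proof -
  have "j \<in> (\<lambda>i. 8 * i + c) ` {0..<int e}" if "j \<in> {0..<8 * int e}" "j mod 8 = c" for j
    using that by (intro rev_image_eqI[of "j div 8"]) (auto simp: div_less_iff_less_mult)
  then have "{j \<in> {0..<8 * int e}. j mod 8 = c} = (\<lambda>i. 8 * i + c) ` {0..<int e}"
    using assms by auto
  then show ?thesis
    by (simp add: card_image inj_on_def)
qed

lemma mod_8_cases:
  fixes j :: int
  obtains "j mod 8 = 0" | "j mod 8 = 1" | "j mod 8 = 2" | "j mod 8 = 3"
    | "j mod 8 = 4" | "j mod 8 = 5" | "j mod 8 = 6" | "j mod 8 = 7"
  using pos_mod_bound[of 8 j] pos_mod_sign[of 8 j] by linarith

lemma periodic_plus_mod:
  assumes "j \<in> periodic e P + periodic e Q"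
  shows "\<exists>p\<in>P. \<exists>r\<in>Q. j mod 8 = (p + r) mod 8"
proof -
  obtain a b where "a \<in> periodic e P" "b \<in> periodic e Q" "j = a + b"
    using assms by (auto elim: set_plus_elim)
  then have "a mod 8 \<in> P" "b mod 8 \<in> Q" "j mod 8 = (a mod 8 + b mod 8) mod 8"
    by (auto simp: periodic_def mod_add_eq)
  then show ?thesis
    by blast
qed

lemma periodic_minus_plus_empty:
  assumes "\<And>j :: int. \<exists>p\<in>P. 0 \<le> p \<and> p \<le> j mod 8 \<and> j mod 8 - p \<in> Q"
  shows "{0..<8 * int e} - (periodic e P + periodic e Q) = {}"
proof -
  have "j \<in> periodic e P + periodic e Q" if "j \<in> {0..<8 * int e}" for j
    using that assms by (rule mem_periodic_plus)
  then show ?thesis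
    by blast
qed

text \<open>The other classes are reached without carry, whereas \<open>c\<close> must be excluded
  modulo 8, since carries could reach it as well.\<close>

lemma periodic_minus_plus_class:
  assumes "\<And>j :: int. j mod 8 \<noteq> c \<Longrightarrow> \<exists>p\<in>P. 0 \<le> p \<and> p \<le> j mod 8 \<and> j mod 8 - p \<in> Q"
    and "\<And>p r. p \<in> P \<Longrightarrow> r \<in> Q \<Longrightarrow> (p + r) mod 8 \<noteq> c"
  shows "{0..<8 * int e} - (periodic e P + periodic e Q) = {j \<in> {0..<8 * int e}. j mod 8 = c}"
proof -
  have "j mod 8 = c \<longleftrightarrow> j \<notin> periodic e P + periodic e Q" if "j \<in> {0..<8 * int e}" for j
  proof
    show "j \<notin> periodic e P + periodic e Q" if "j mod 8 = c"
      using periodic_plus_mod[of j e P Q] assms(2) that by metis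
    show "j mod 8 = c" if "j \<notin> periodic e P + periodic e Q"
      using mem_periodic_plus[OF \<open>j \<in> {0..<8 * int e}\<close> assms(1)] that by blast
  qed
  then show ?thesis
    by blast
qed

lemma realizable_periodic:
  assumes "0 \<in> P" "0 \<in> Q" "0 < e"
    and "card ({0..<8 * int e} - (periodic e P + periodic e P)) = s"
    and "{0..<8 * int e} - (periodic e Q + periodic e Q) = {}"
    and "{0..<8 * int e} - (periodic e P + periodic e Q) = {j \<in> {0..<8 * int e}. j mod 8 = c}"
    and "0 \<le> c" "c < 8"
  shows "realizable (int s, 2 * int e)"
proof -
  have "{0..int (8 * e - 1)} = {0..<8 * int e}"
    using assms(3) by auto
  then have "profile (8 * e - 1) (periodic e P) (periodic e Q) = (int s, 2 * int e)"
    unfolding profile_def using assms(4-6) card_mod_8_eq[OF assms(7,8)] by simp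
  moreover have "periodic e P' \<subseteq> {0..<int (8 * e)}" "0 \<in> P' \<Longrightarrow> 0 \<in> periodic e P'" for P'
    using assms(3) by (auto simp: periodic_def)
  ultimately show ?thesis
    using realizable_profile[of "periodic e P" "8 * e" "periodic e Q"] assms(1,2) by simp
qed

text \<open>The residues modulo 8 below were found by exhaustive search: every residue is a sum of two
  elements of \<open>P\<close> and of two elements of \<open>Q\<close> without carry, while \<open>P + Q\<close> misses exactly one class,
  so that a fringe of length \<open>8 * e\<close> loses exactly \<open>e\<close> differences at each end.\<close>

lemma realizable_no_sum:
  assumes "0 < e"
  shows "realizable (0, 2 * int e)"
proof -
  let ?P = "{0, 1, 3, 4 :: int}" and ?Q = "{0, 1, 2, 5 :: int}"
  have "\<exists>p\<in>?P. 0 \<le> p \<and> p \<le> j mod 8 \<and> j mod 8 - p \<in> ?P" for j :: int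
    by (cases j rule: mod_8_cases) auto
  then have "{0..<8 * int e} - (periodic e ?P + periodic e ?P) = {}"
    by (rule periodic_minus_plus_empty)
  moreover have "\<exists>p\<in>?Q. 0 \<le> p \<and> p \<le> j mod 8 \<and> j mod 8 - p \<in> ?Q" for j :: int
    by (cases j rule: mod_8_cases) auto
  then have "{0..<8 * int e} - (periodic e ?Q + periodic e ?Q) = {}"
    by (rule periodic_minus_plus_empty)
  moreover have "{0..<8 * int e} - (periodic e ?P + periodic e ?Q) = {j \<in> {0..<8 * int e}. j mod 8 = 7}"
  proof (rule periodic_minus_plus_class)
    show "\<exists>p\<in>?P. 0 \<le> p \<and> p \<le> j mod 8 \<and> j mod 8 - p \<in> ?Q" if "j mod 8 \<noteq> 7" for j :: int
      using that by (cases j rule: mod_8_cases) auto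
  qed auto
  ultimately show ?thesis
    using realizable_periodic[of ?P ?Q e 0 7] assms by simp
qed

text \<open>Here \<open>1\<close> is not a sum of two elements of \<open>P\<close> but \<open>9 = 2 + 7\<close> is, so a single sum is lost.\<close>

lemma realizable_one_sum:
  assumes "0 < e"
  shows "realizable (1, 2 * int e)"
proof -
  let ?P = "{0, 2, 3, 7 :: int}" and ?Q = "{0, 1, 2, 5 :: int}"
  have "j \<in> periodic e ?P + periodic e ?P \<longleftrightarrow> j \<noteq> 1" if j: "j \<in> {0..<8 * int e}" for j
  proof (cases "j mod 8 = 1")
    case True
    show ?thesis
    proof (cases "j = 1")
      case True
      have "1 \<notin> periodic e ?P + periodic e ?P"
      proof
        assume "1 \<in> periodic e ?P + periodic e ?P"
        then obtain a b where ab: "a \<in> periodic e ?P" "b \<in> periodic e ?P" "1 = a + b"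
          by (auto elim: set_plus_elim)
        then have "a = 1 \<or> b = 1"
          by (auto simp: periodic_def)
        with ab show False
          by (auto simp: periodic_def)
      qed
      with True show ?thesis
        by simp
    next
      case False
      \<comment> \<open>Apart from 1 itself, the class of 1 starts at 9, where a carry is possible:
        \<open>j - 2\<close> is nonnegative and has residue 7.\<close>
      define m where "m = j div 8 - 1"
      have m: "j - 2 = 7 + 8 * m"
        using \<open>j mod 8 = 1\<close> div_mult_mod_eq[of j 8] by (simp add: m_def)
      then have "m \<noteq> - 1" "- 9 \<le> 8 * m"
        using False j by auto
      then have "m \<ge> 0"
        by arith
      then have "j \<ge> 9" "(j - 2) mod 8 = 7"
        using m by auto
      then have "2 \<in> periodic e ?P" "j - 2 \<in> periodic e ?P"
        using j by (auto simp: periodic_def)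
      then have "2 + (j - 2) \<in> periodic e ?P + periodic e ?P"
        by (rule set_plus_intro)
      with False show ?thesis
        by simp
    qed
  next
    case False
    then have "\<exists>p\<in>?P. 0 \<le> p \<and> p \<le> j mod 8 \<and> j mod 8 - p \<in> ?P"
      by (cases j rule: mod_8_cases) auto
    then have "j \<in> periodic e ?P + periodic e ?P"
      by (rule mem_periodic_plus[OF j])
    with False show ?thesis
      by auto
  qed
  then have "{0..<8 * int e} - (periodic e ?P + periodic e ?P) = {1}"
    using assms by auto
  moreover have "\<exists>p\<in>?Q. 0 \<le> p \<and> p \<le> j mod 8 \<and> j mod 8 - p \<in> ?Q" for j :: int
    by (cases j rule: mod_8_cases) auto
  then have "{0..<8 * int e} - (periodic e ?Q + periodic e ?Q) = {}"
    by (rule periodic_minus_plus_empty)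
  moreover have "{0..<8 * int e} - (periodic e ?P + periodic e ?Q) = {j \<in> {0..<8 * int e}. j mod 8 = 6}"
  proof (rule periodic_minus_plus_class)
    show "\<exists>p\<in>?P. 0 \<le> p \<and> p \<le> j mod 8 \<and> j mod 8 - p \<in> ?Q" if "j mod 8 \<noteq> 6" for j :: int
      using that by (cases j rule: mod_8_cases) auto
  qed auto
  ultimately show ?thesis
    using realizable_periodic[of ?P ?Q e 1 6] assms by simp
qed

text \<open>Translation raises both coordinates by 2, so the induction on \<open>e\<close> needs
  explicit periodic fringes only for \<open>s = 0\<close> and \<open>s = 1\<close>.\<close>

lemma realizable_even: "realizable (int s, 2 * int e)"
proof (induction e arbitrary: s)
  case 0
  show ?case
    using realizable_no_difference by simp
next
  case (Suc e)
  consider "s = 0" | "s = 1" | s' where "s = s' + 2"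
    by (metis One_nat_def add_2_eq_Suc' not0_implies_Suc)
  then show ?case
  proof cases
    case 1
    then show ?thesis
      using realizable_no_sum[of "Suc e"] by simp
  next
    case 2
    then show ?thesis
      using realizable_one_sum[of "Suc e"] by simp
  next
    case 3
    then show ?thesis
      using realizable_translate[OF Suc.IH[of s']] by (simp add: algebra_simps)
  qed
qed

section \<open>Decoupling of the middle from the fringe\<close>

theorem theorem5p1:
  fixes \<Lambda> :: "(int \<times> int) set" and \<alpha> :: "nat \<Rightarrow> int" and \<epsilon> :: real
  assumes "\<Lambda> \<subseteq> {0..} \<times> {0..}"
    and "\<exists>s d. (s, d) \<in> \<Lambda> \<and> even d"
    and "\<forall>\<^sub>F n in sequentially. 0 < \<alpha> n \<and> real_of_int (\<alpha> n) < real n / 2"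
    and "filterlim \<alpha> at_top sequentially"
    and "\<epsilon> > 0"
  shows "\<exists>N. \<forall>n\<ge>N. \<forall>E F.
    depends_only_on n {\<alpha> n + 1..int n - \<alpha> n - 1} E \<longrightarrow>
    depends_only_on n ({0..\<alpha> n} \<union> {int n - \<alpha> n..int n}) F \<longrightarrow>
    \<bar>\<P>(S in random_subset n. E S \<and> F S \<bar> lam n S \<in> \<Lambda>)
       - \<P>(S in random_subset n. E S) * \<P>(S in random_subset n. F S \<bar> lam n S \<in> \<Lambda>)\<bar>
    \<le> (1 + \<epsilon>) * (24 * (3 / 4) powr (real_of_int (\<alpha> n) / 2) / ((2 - sqrt 3) * rho \<Lambda>))"
proof -
  obtain s d where sd: "(s, d) \<in> \<Lambda>" "even d"
    using assms(2) by blast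
  then have "s = int (nat s)" "d = 2 * int (nat (d div 2))"
    using assms(1) by (auto elim!: evenE)
  then have "realizable (s, d)"
    using realizable_even[of "nat s" "nat (d div 2)"] by simp
  then have rho: "0 < rho \<Lambda>"
    using sd(1) by (rule rho_pos)
  \<comment> \<open>Half of \<open>rho \<Lambda>\<close> is a positive lower bound for the
    conditioning probability; it accounts for one factor 2 in 24.\<close>
  then have "\<forall>\<^sub>F n in sequentially. rho \<Lambda> / 2 < pr n (\<lambda>S. lam n S \<in> \<Lambda>)"
    by (intro order_tendstoD(1)[OF pr_lam_tendsto_rho]) simp
  then have "\<forall>\<^sub>F n in sequentially. rho \<Lambda> / 2 < pr n (\<lambda>S. lam n S \<in> \<Lambda>) \<and>
      0 < \<alpha> n \<and> real_of_int (\<alpha> n) < real n / 2"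
    using assms(3) by (rule eventually_conj)
  then obtain N where N: "rho \<Lambda> / 2 < pr n (\<lambda>S. lam n S \<in> \<Lambda>)" "0 < \<alpha> n" "real_of_int (\<alpha> n) < real n / 2"
    if "n \<ge> N" for n
    unfolding eventually_sequentially by blast
  \<comment> \<open>The threshold \<open>N\<close> is fixed before \<open>E\<close> and
    \<open>F\<close>, so the estimate is uniform in the events.\<close>
  show ?thesis
  proof (intro exI[of _ N] allI impI)
    fix n E F
    assume n: "N \<le> n" and E: "depends_only_on n {\<alpha> n + 1..int n - \<alpha> n - 1} E"
      and F: "depends_only_on n ({0..\<alpha> n} \<union> {int n - \<alpha> n..int n}) F"
    define k where "k = nat (\<alpha> n)"
    define p where "p = pr n (\<lambda>S. lam n S \<in> \<Lambda>)"
    let ?a = "pr n (\<lambda>S. (E S \<and> F S) \<and> lam n S \<in> \<Lambda>)" and ?b = "pr n (\<lambda>S. F S \<and> lam n S \<in> \<Lambda>)"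
      and ?t = "24 * (3 / 4) powr (real_of_int (\<alpha> n) / 2) / ((2 - sqrt 3) * rho \<Lambda>)"
    have k: "\<alpha> n = int k" "2 * k < n"
      using N[OF n] by (auto simp: k_def)
    have p: "rho \<Lambda> / 2 < p"
      using N(1)[OF n] by (simp add: p_def)
    have qk: "q ^ k = (3 / 4) powr (real_of_int (\<alpha> n) / 2)"
    proof -
      have "q = (3 / 4) powr (1 / 2)"
        by (simp add: powr_half_sqrt q_def real_sqrt_divide)
      then have "q powr real k = ((3 / 4) powr (1 / 2)) powr real k"
        by (rule arg_cong)
      then show ?thesis
        using q_bounds(2) by (simp add: k(1) powr_powr powr_realpow)
    qed
    have q': "1 - q = (2 - sqrt 3) / 2"
      by (simp add: q_def field_simps)
    \<comment> \<open>The constant is \<open>24 = 6 * 2 * 2\<close>: 6 from the decoupling, 2 from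
      \<open>1 - q = (2 - sqrt 3) / 2\<close>, and 2 from \<open>rho \<Lambda> / 2\<close>.\<close>
    have "24 * x / (D * r) = 6 * x / (D / 2) / (r / 2)" for x D r :: real
      by simp
    then have t: "?t = 6 * q ^ k / (1 - q) / (rho \<Lambda> / 2)"
      unfolding qk q' .
    have "0 < 6 * q ^ k / (1 - q)"
      using q_bounds by simp
    have "\<bar>?a / p - pr n E * (?b / p)\<bar> = \<bar>?a - pr n E * ?b\<bar> / p"
      using p rho by (simp add: abs_divide flip: diff_divide_distrib)
    also have "\<dots> \<le> 6 * q ^ (k + 1) / (1 - q) / p"
      using fringe_decoupling[OF k(2), of E F \<Lambda>] E F p rho
      by (intro divide_right_mono) (auto simp: k(1))
    also have "\<dots> \<le> 6 * q ^ k / (1 - q) / p"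
      using q_bounds p rho q_power_antimono[of k "k + 1"]
      by (intro divide_right_mono mult_left_mono) auto
    also have "\<dots> \<le> ?t"
      unfolding t using p rho \<open>0 < 6 * q ^ k / (1 - q)\<close> by (intro divide_left_mono) auto
    also have "\<dots> \<le> (1 + \<epsilon>) * ?t"
    proof -
      have "0 \<le> ?t"
        unfolding t using q_bounds rho by (intro divide_nonneg_pos) auto
      then show ?thesis
        using mult_right_mono[of 1 "1 + \<epsilon>" ?t] assms(5) by linarith
    qed
    finally have "\<bar>?a / p - pr n E * (?b / p)\<bar> \<le> (1 + \<epsilon>) * ?t" .
    moreover have "space (random_subset n) = UNIV"
      by (simp add: random_subset_def)
    ultimately show "\<bar>\<P>(S in random_subset n. E S \<and> F S \<bar> lam n S \<in> \<Lambda>)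
        - \<P>(S in random_subset n. E S) * \<P>(S in random_subset n. F S \<bar> lam n S \<in> \<Lambda>)\<bar>
        \<le> (1 + \<epsilon>) * ?t"
      by (simp add: cond_prob_def measure_random_subset p_def)
  qed
qed

end
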